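(* Let $V$ be a complex vector space and let $P=\mathbb{C}[\partial]\otimes V$ be the free $\mathbb{C}[\partial]$-module over $V$, equipped with two $\mathbb{C}$-bilinear maps $P\times P\to P[\lambda]$, $(a,b)\mapsto a\circ_\lambda b$ and $(a,b)\mapsto[a_\lambda b]$, each of which makes $P$ a conformal algebra. Then $(P,\circ_\lambda,[\cdot_\lambda\cdot])$ is a quadratic (noncommutative) Poisson conformal algebra if and only if there are bilinear operations $\ast,\circ,[\cdot,\cdot]$ on $V$ such that for all $a,b\in V$ $$a\circ_\lambda b=a\circ b,\qquad [a_\lambda b]=\partial(b\ast a)+\lambda(a\ast b+b\ast a)+[b,a],$$ $(V,\ast,[\cdot,\cdot])$ is a Gel'fand-Dorfman bialgebra, $(V,\circ,[\cdot,\cdot])$ is a (noncommutative) Poisson algebra, and for all $a,b,c\in V$ $$(b\circ c)\ast a=b\circ(c\ast a)=(b\ast a)\circ c,$$ $$a\ast(b\circ c)=(a\ast b)\circ c+b\circ(a\ast c).$$ The statement holds in both versions: with the word "(noncommutative)" included throughout, or omitted throughout.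
   Context: All vector spaces are over $\mathbb{C}$. A conformal algebra is a $\mathbb{C}[\partial]$-module $A$ with a $\mathbb{C}$-bilinear map $A\times A\to A[\lambda]$, $(a,b)\mapsto a_\lambda b$, such that $(\partial a)_\lambda b=-\lambda\, a_\lambda b$ and $a_\lambda(\partial b)=(\partial+\lambda)(a_\lambda b)$. In expressions such as $b_{-\lambda-\partial}a$, the variable is replaced by $-\lambda-\partial$ with $\partial$ moved to the left, acting on the coefficients. An associative conformal algebra is a conformal algebra $(A,\circ_\lambda)$ with $a\circ_\lambda(b\circ_\mu c)=(a\circ_\lambda b)\circ_{\lambda+\mu}c$; it is commutative if $a\circ_\lambda b=b\circ_{-\lambda-\partial}a$. A Lie conformal algebra is a conformal algebra $(A,[\cdot_\lambda\cdot])$ with $[a_\lambda b]=-[b_{-\lambda-\partial}a]$ and $[a_\lambda[b_\mu c]]=[[a_\lambda b]_{\lambda+\mu}c]+[b_\mu[a_\lambda c]]$. A Poisson conformal algebra is a $\mathbb{C}[\partial]$-module $P$ with a commutative associative conformal algebra structure $\circ_\lambda$ and a Lie conformal algebra structure $[\cdot_\lambda\cdot]$ satisfying $[a_\lambda(b\circ_\mu c)]=[a_\lambda b]\circ_{\lambda+\mu}c+b\circ_\mu[a_\lambda c]$. A noncommutative Poisson conformal algebra is defined in the same way without requiring commutativity of $\circ_\lambda$. A (noncommutative) Poisson algebra is a vector space with a commutative associative (respectively, for "noncommutative", an associative) product $\circ$ and a Lie bracket $[\cdot,\cdot]$ with $[a,b\circ c]=[a,b]\circ c+b\circ[a,c]$.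 A Lie conformal algebra structure on the free module $\mathbb{C}[\partial]\otimes V$ is quadratic if for all $a,b\in V$ one has $[a_\lambda b]=\partial u+\lambda v+w$ with $u,v,w\in V$. An associative conformal algebra structure on $\mathbb{C}[\partial]\otimes V$ is a current associative conformal algebra if $a\circ_\lambda b=a\circ b\in V$ for all $a,b\in V$, where $(V,\circ)$ is an associative algebra. A (noncommutative) Poisson conformal algebra $P=\mathbb{C}[\partial]\otimes V$ is quadratic if its associative conformal algebra is current and its Lie conformal algebra is quadratic. A Novikov algebra is a vector space $A$ with a bilinear product $\ast$ such that $(a\ast b)\ast c=(a\ast c)\ast b$ and $(a\ast b)\ast c-a\ast(b\ast c)=(b\ast a)\ast c-b\ast(a\ast c)$. A Gel'fand-Dorfman bialgebra (GD-algebra) is a triple $(A,\ast,[\cdot,\cdot])$ such that $(A,[\cdot,\cdot])$ is a Lie algebra, $(A,\ast)$ is a Novikov algebra and $[a\ast b,c]+[a,b]\ast c-a\ast[b,c]-[a\ast c,b]-[a,c]\ast b=0$ for all $a,b,c$. *)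

theory Defs
  imports "HOL-Computational_Algebra.Polynomial"
begin

section \<open>Modules over the polynomial ring and formal variables\<close>

text \<open>
  A module over the ring of complex polynomials in \<open>\<partial>\<close> is a \<^locale>\<open>module\<close> over
  \<^typ>\<open>complex poly\<close>; the indeterminate acts as \<open>\<partial>\<close> and the constants give the underlying
  complex vector space. For a module \<open>A\<close> of type \<open>'a\<close>, the elements of \<open>A[\<lambda>]\<close> are of type
  \<open>'a poly\<close>. Elements of \<open>A[\<lambda>,\<mu>]\<close> are of type \<open>'a poly poly\<close>, with outer variable \<open>\<lambda>\<close> and
  inner variable \<open>\<mu>\<close>.
\<close>

abbreviation del :: "(complex poly \<Rightarrow> 'a \<Rightarrow> 'a) \<Rightarrow> 'a \<Rightarrow> 'a"
  where "del act \<equiv> act [:0, 1:]"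

abbreviation cscale :: "(complex poly \<Rightarrow> 'a \<Rightarrow> 'a) \<Rightarrow> complex \<Rightarrow> 'a \<Rightarrow> 'a"
  where "cscale act c \<equiv> act [:c:]"

text \<open>
  If \<open>T\<close> is the operator of multiplication by some expression \<open>t\<close>, then \<open>subst_var T h F\<close>
  is the sum of the \<open>t\<^sup>i h(F\<^sub>i)\<close>, where \<open>F\<^sub>i\<close> are the coefficients of \<open>F\<close>: the variable of \<open>F\<close>
  is replaced by \<open>t\<close>, written on the left, and \<open>h\<close> is applied to the coefficients.
\<close>

definition subst_var :: "('b \<Rightarrow> 'b) \<Rightarrow> ('a::zero \<Rightarrow> 'b::comm_monoid_add) \<Rightarrow> 'a poly \<Rightarrow> 'b"
  where "subst_var T h F = (\<Sum>i\<le>degree F. (T ^^ i) (h (coeff F i)))"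

text \<open>\<open>skew_subst act F\<close> is \<open>F\<close> with its variable replaced by \<open>- \<lambda> - \<partial>\<close>.\<close>

definition skew_subst :: "(complex poly \<Rightarrow> 'a \<Rightarrow> 'a) \<Rightarrow> 'a::ab_group_add poly \<Rightarrow> 'a poly"
  where "skew_subst act = subst_var (\<lambda>X. - pCons 0 X - map_poly (del act) X) (\<lambda>x. [:x:])"

definition mult_lam :: "'a::ab_group_add poly poly \<Rightarrow> 'a poly poly"
  where "mult_lam X = pCons 0 X"

definition mult_mu :: "'a::ab_group_add poly poly \<Rightarrow> 'a poly poly"
  where "mult_mu X = map_poly (pCons 0) X"

definition mult_lam_mu :: "'a::ab_group_add poly poly \<Rightarrow> 'a poly poly"
  where "mult_lam_mu X = mult_lam X + mult_mu X"

definition const2 :: "'a::ab_group_add \<Rightarrow> 'a poly poly"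
  where "const2 x = [:[:x:]:]"

text \<open>
  For two products \<open>f\<close> and \<open>g\<close> with values in \<open>A[\<lambda>]\<close>, written \<open>a f\<^sub>\<lambda> b\<close> and \<open>a g\<^sub>\<lambda> b\<close>, the
  following three terms are \<open>a f\<^sub>\<lambda> (b g\<^sub>\<mu> c)\<close>, \<open>b f\<^sub>\<mu> (a g\<^sub>\<lambda> c)\<close> and
  \<open>(a f\<^sub>\<lambda> b) g\<^bsub>\<lambda>+\<mu>\<^esub> c\<close> in \<open>A[\<lambda>,\<mu>]\<close>.
\<close>

definition lam_of_mu ::
    "('a \<Rightarrow> 'a \<Rightarrow> 'a poly) \<Rightarrow> ('a \<Rightarrow> 'a \<Rightarrow> 'a poly) \<Rightarrow> 'a::ab_group_add \<Rightarrow> 'a \<Rightarrow> 'a \<Rightarrow> 'a poly poly"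
  where "lam_of_mu f g a b c =
    subst_var mult_mu (\<lambda>x. subst_var mult_lam const2 (f a x)) (g b c)"

definition mu_of_lam ::
    "('a \<Rightarrow> 'a \<Rightarrow> 'a poly) \<Rightarrow> ('a \<Rightarrow> 'a \<Rightarrow> 'a poly) \<Rightarrow> 'a::ab_group_add \<Rightarrow> 'a \<Rightarrow> 'a \<Rightarrow> 'a poly poly"
  where "mu_of_lam f g b a c =
    subst_var mult_lam (\<lambda>x. subst_var mult_mu const2 (f b x)) (g a c)"

definition lam_then_sum ::
    "('a \<Rightarrow> 'a \<Rightarrow> 'a poly) \<Rightarrow> ('a \<Rightarrow> 'a \<Rightarrow> 'a poly) \<Rightarrow> 'a::ab_group_add \<Rightarrow> 'a \<Rightarrow> 'a \<Rightarrow> 'a poly poly"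
  where "lam_then_sum f g a b c =
    subst_var mult_lam (\<lambda>x. subst_var mult_lam_mu const2 (g x c)) (f a b)"

definition cbilinear ::
    "(complex \<Rightarrow> 'a \<Rightarrow> 'a) \<Rightarrow> (complex \<Rightarrow> 'b \<Rightarrow> 'b) \<Rightarrow> (complex \<Rightarrow> 'c \<Rightarrow> 'c)
      \<Rightarrow> ('a::ab_group_add \<Rightarrow> 'b::ab_group_add \<Rightarrow> 'c::ab_group_add) \<Rightarrow> bool"
  where "cbilinear s1 s2 s3 f \<longleftrightarrow>
    (\<forall>a. Vector_Spaces.linear s2 s3 (f a)) \<and> (\<forall>b. Vector_Spaces.linear s1 s3 (\<lambda>a. f a b))"


section \<open>Conformal algebras\<close>

locale conformal_algebra = module act
  for act :: "complex poly \<Rightarrow> 'a::ab_group_add \<Rightarrow> 'a" +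
  fixes lprod :: "'a \<Rightarrow> 'a \<Rightarrow> 'a poly"
  assumes lprod_bilinear:
      "cbilinear (cscale act) (cscale act) (\<lambda>c. map_poly (cscale act c)) lprod"
    and lprod_del_left: "lprod (del act a) b = - pCons 0 (lprod a b)"
    and lprod_del_right:
      "lprod a (del act b) = map_poly (del act) (lprod a b) + pCons 0 (lprod a b)"

locale associative_conformal_algebra = conformal_algebra act lprod
  for act :: "complex poly \<Rightarrow> 'a::ab_group_add \<Rightarrow> 'a" and lprod +
  assumes lprod_assoc: "lam_of_mu lprod lprod a b c = lam_then_sum lprod lprod a b c"

locale comm_associative_conformal_algebra = associative_conformal_algebra act lprod
  for act :: "complex poly \<Rightarrow> 'a::ab_group_add \<Rightarrow> 'a" and lprod +
  assumes lprod_commute: "lprod a b = skew_subst act (lprod b a)"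

locale lie_conformal_algebra = conformal_algebra act lbr
  for act :: "complex poly \<Rightarrow> 'a::ab_group_add \<Rightarrow> 'a" and lbr +
  assumes lbr_skew: "lbr a b = - skew_subst act (lbr b a)"
    and lbr_jacobi:
      "lam_of_mu lbr lbr a b c = lam_then_sum lbr lbr a b c + mu_of_lam lbr lbr b a c"

locale nc_poisson_conformal_algebra =
  assoc: associative_conformal_algebra act lprod + lie: lie_conformal_algebra act lbr
  for act :: "complex poly \<Rightarrow> 'a::ab_group_add \<Rightarrow> 'a" and lprod and lbr +
  assumes lbr_leibniz:
    "lam_of_mu lbr lprod a b c = lam_then_sum lbr lprod a b c + mu_of_lam lprod lbr b a c"

locale poisson_conformal_algebra =
  nc_poisson_conformal_algebra act lprod lbr + comm: comm_associative_conformal_algebra act lprod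
  for act :: "complex poly \<Rightarrow> 'a::ab_group_add \<Rightarrow> 'a" and lprod and lbr


section \<open>Algebras over the complex numbers\<close>

locale associative_algebra = vector_space scale
  for scale :: "complex \<Rightarrow> 'v::ab_group_add \<Rightarrow> 'v" +
  fixes mult :: "'v \<Rightarrow> 'v \<Rightarrow> 'v"
  assumes mult_bilinear: "cbilinear scale scale scale mult"
    and mult_assoc: "mult (mult a b) c = mult a (mult b c)"

locale lie_algebra = vector_space scale
  for scale :: "complex \<Rightarrow> 'v::ab_group_add \<Rightarrow> 'v" +
  fixes br :: "'v \<Rightarrow> 'v \<Rightarrow> 'v"
  assumes br_bilinear: "cbilinear scale scale scale br"
    and br_self: "br a a = 0"
    and br_jacobi: "br a (br b c) = br (br a b) c + br b (br a c)"

locale nc_poisson_algebra = associative_algebra scale mult + lie_algebra scale br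
  for scale :: "complex \<Rightarrow> 'v::ab_group_add \<Rightarrow> 'v" and mult and br +
  assumes br_leibniz: "br a (mult b c) = mult (br a b) c + mult b (br a c)"

locale poisson_algebra = nc_poisson_algebra scale mult br
  for scale :: "complex \<Rightarrow> 'v::ab_group_add \<Rightarrow> 'v" and mult and br +
  assumes mult_commute: "mult a b = mult b a"

locale novikov_algebra = vector_space scale
  for scale :: "complex \<Rightarrow> 'v::ab_group_add \<Rightarrow> 'v" +
  fixes ast :: "'v \<Rightarrow> 'v \<Rightarrow> 'v"
  assumes ast_bilinear: "cbilinear scale scale scale ast"
    and ast_right_commute: "ast (ast a b) c = ast (ast a c) b"
    and ast_left_symmetric:
      "ast (ast a b) c - ast a (ast b c) = ast (ast b a) c - ast b (ast a c)"

locale gd_algebra = lie_algebra scale br + novikov_algebra scale ast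
  for scale :: "complex \<Rightarrow> 'v::ab_group_add \<Rightarrow> 'v" and ast and br +
  assumes gd_identity:
    "br (ast a b) c + ast (br a b) c - ast a (br b c) - br (ast a c) b - ast (br a c) b = 0"


section \<open>Quadratic structures on free modules\<close>

text \<open>
  The free module over a complex vector space \<open>V\<close> of type \<open>'v\<close> is \<open>'v poly\<close>, the polynomials in
  \<open>\<partial>\<close> with coefficients in \<open>V\<close>; an element \<open>a\<close> of \<open>V\<close> is identified with \<open>[:a:]\<close>. Accordingly
  \<open>[:[:a:]:]\<close> of type \<open>'v poly poly\<close> is \<open>a\<close> as an element of \<open>P[\<lambda>]\<close>.
\<close>

definition free_act ::
    "(complex \<Rightarrow> 'v \<Rightarrow> 'v) \<Rightarrow> complex poly \<Rightarrow> 'v::ab_group_add poly \<Rightarrow> 'v poly"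
  where "free_act scale p x = (\<Sum>i\<le>degree p. (pCons 0 ^^ i) (map_poly (scale (coeff p i)) x))"

context
  fixes scale :: "complex \<Rightarrow> 'v::ab_group_add \<Rightarrow> 'v"
  assumes vs: "vector_space scale"
begin

interpretation vector_space scale by (rule vs)

lemma map_poly_scale_0: "map_poly (scale 0) x = 0"
  by (rule poly_eqI) (simp add: coeff_map_poly)

lemma map_poly_scale_add:
  "map_poly (scale c) (x + y) = map_poly (scale c) x + map_poly (scale c) y"
  by (rule poly_eqI) (simp add: coeff_map_poly scale_right_distrib)

lemma map_poly_scale_pCons:
  "map_poly (scale c) (pCons a x) = pCons (scale c a) (map_poly (scale c) x)"
  by (rule poly_eqI) (simp add: coeff_map_poly coeff_pCons split: nat.split)

lemma free_act_pCons:
  "free_act scale (pCons c p) x = map_poly (scale c) x + pCons 0 (free_act scale p x)"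
proof (cases "p = 0")
  case True
  then show ?thesis
    by (simp add: free_act_def map_poly_scale_0)
next
  case False
  have pCons_sum: "pCons 0 (sum f A) = (\<Sum>i\<in>A. pCons 0 (f i))" if "finite A"
    for f :: "nat \<Rightarrow> 'v poly" and A
    using that
  proof (induction A rule: finite_induct)
    case (insert a A)
    then show ?case
      using add_pCons[of 0 "f a" 0 "sum f A"] by simp
  qed simp
  from False show ?thesis
    by (simp add: free_act_def sum.atMost_Suc_shift pCons_sum del: sum.atMost_Suc)
qed

lemma free_act_0_left: "free_act scale 0 x = 0"
  by (rule poly_eqI) (simp add: free_act_def coeff_map_poly)

lemma free_act_const: "free_act scale [:c:] x = map_poly (scale c) x"
  by (simp add: free_act_pCons free_act_0_left)

lemma free_act_del: "free_act scale [:0, 1:] x = pCons 0 x"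
  by (rule poly_eqI)
    (simp add: free_act_pCons free_act_0_left coeff_map_poly coeff_pCons split: nat.split)

lemma free_act_add_right: "free_act scale p (x + y) = free_act scale p x + free_act scale p y"
  by (induction p)
    (simp_all add: free_act_0_left free_act_pCons map_poly_scale_add add_ac)

lemma free_act_add_left: "free_act scale (p + q) x = free_act scale p x + free_act scale q x"
proof (induction p q rule: poly_induct2)
  case (pCons a p b q)
  have "map_poly (scale (a + b)) x = map_poly (scale a) x + map_poly (scale b) x"
    by (rule poly_eqI) (simp add: coeff_map_poly scale_left_distrib)
  then show ?case
    using pCons by (simp add: free_act_pCons add_ac)
qed (simp add: free_act_0_left)

lemma free_act_smult:
  "free_act scale (smult c p) x = map_poly (scale c) (free_act scale p x)"
proof (induction p)
  case (pCons a p)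
  have "map_poly (scale (c * a)) x = map_poly (scale c) (map_poly (scale a) x)"
    by (rule poly_eqI) (simp add: coeff_map_poly)
  then show ?case
    using pCons by (simp add: free_act_pCons map_poly_scale_add map_poly_scale_pCons)
qed (simp add: free_act_0_left)

lemma free_act_mult: "free_act scale (p * q) x = free_act scale p (free_act scale q x)"
  by (induction p)
    (simp_all add: free_act_0_left free_act_pCons free_act_add_left free_act_smult mult_pCons_left
      map_poly_scale_0)

lemma module_free_act: "module (free_act scale)"
proof
  show "free_act scale 1 x = x" for x
    by (rule poly_eqI) (simp add: one_pCons free_act_const coeff_map_poly)
qed (simp_all add: free_act_add_right free_act_add_left free_act_mult)

end

locale quadratic_lie_conformal_algebra =
  V: vector_space scale + lie_conformal_algebra "free_act scale" lbr
  for scale :: "complex \<Rightarrow> 'v::ab_group_add \<Rightarrow> 'v" and lbr +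
  assumes lbr_quadratic:
    "\<exists>u v w. lbr [:a:] [:b:] = [: del (free_act scale) [:u:] + [:w:], [:v:] :]"

locale current_associative_conformal_algebra =
  V: vector_space scale + associative_conformal_algebra "free_act scale" lprod
  for scale :: "complex \<Rightarrow> 'v::ab_group_add \<Rightarrow> 'v" and lprod +
  assumes lprod_current:
    "\<exists>mult. associative_algebra scale mult \<and> (\<forall>a b. lprod [:a:] [:b:] = [:[:mult a b:]:])"

locale quadratic_nc_poisson_conformal_algebra =
  nc_poisson_conformal_algebra "free_act scale" lprod lbr +
  current: current_associative_conformal_algebra scale lprod +
  quadratic: quadratic_lie_conformal_algebra scale lbr
  for scale :: "complex \<Rightarrow> 'v::ab_group_add \<Rightarrow> 'v" and lprod and lbr

locale quadratic_poisson_conformal_algebra =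
  poisson_conformal_algebra "free_act scale" lprod lbr +
  current: current_associative_conformal_algebra scale lprod +
  quadratic: quadratic_lie_conformal_algebra scale lbr
  for scale :: "complex \<Rightarrow> 'v::ab_group_add \<Rightarrow> 'v" and lprod and lbr

end

theory Submission
  imports Defs
begin

text \<open>
  Every axiom of a Poisson conformal algebra equates two expressions in two or three elements of
  the module. Each of these expressions is additive in every argument, and \<open>\<partial>\<close> can be pulled out of
  an argument at the price of a factor that depends only on the position of the argument, not on
  the expression: in the three-fold expressions \<open>\<partial>a\<close> gives \<open>-\<lambda>\<close>, \<open>\<partial>b\<close> gives \<open>-\<mu>\<close> and \<open>\<partial>c\<close> gives
  \<open>\<partial> + \<lambda> + \<mu>\<close>. This is the content of the locales \<open>sesquilinear\<close> and \<open>sesquilinear3\<close>. As the free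
  module is generated by \<open>V\<close> over the polynomials in \<open>\<partial>\<close>, an axiom holds on all of it as soon as
  it holds on \<open>V\<close> (\<open>sesquilinear_eqI\<close>, \<open>sesquilinear3_eqI\<close>).

  On \<open>V\<close>, write the bracket as \<open>\<partial>u(a,b) + \<lambda>v(a,b) + w(a,b)\<close>. Replacing \<open>\<lambda>\<close> by \<open>-\<lambda>-\<partial>\<close> in
  skew-symmetry gives \<open>v(b,a) = u(a,b) + u(b,a)\<close> and \<open>w(a,b) = -w(b,a)\<close>, so that
  \<open>a * b = u(b,a)\<close> and \<open>[a,b] = w(b,a)\<close> bring the bracket into the asserted form. The Jacobi and
  Leibniz identities then become equations between polynomials in \<open>\<lambda>\<close>, \<open>\<mu>\<close>, \<open>\<partial>\<close> of degree at most
  two with coefficients in \<open>V\<close>, which are compared coefficientwise.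

  For Jacobi, the coefficient of \<open>\<partial>\<^sup>2\<close> is right commutativity of \<open>*\<close>, that of \<open>\<lambda>\<^sup>2\<close> is then
  left symmetry, that of \<open>\<partial>\<close> is the Gel'fand-Dorfman identity, and the constant term is the Jacobi
  identity of \<open>V\<close>; the six others follow from these four (\<open>jacobi_constants_iff\<close>). For Leibniz,
  the coefficients of \<open>\<partial>\<close>, \<open>\<mu>\<close>, \<open>\<lambda>\<close> and \<open>1\<close> give the two compatibility conditions between \<open>*\<close> and
  \<open>\<circ>\<close>, the derivation property of \<open>a *\<close>, and the Leibniz rule of \<open>V\<close>
  (\<open>leibniz_constants_iff\<close>). Associativity and commutativity of a current product are those
  of \<open>\<circ>\<close>.
\<close>

section \<open>Additive maps and substitution for a formal variable\<close>

lemma additive_rules: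
  assumes "additive f"
  shows "f (x + y) = f x + f y" and "f 0 = 0" and "f (- x) = - f x" and "f (x - y) = f x - f y"
  using assms by (simp_all add: additive.add additive.zero additive.minus additive.diff)

lemma additive_map_poly:
  assumes "additive G"
  shows "additive (map_poly G)"
  by (rule additive.intro, rule poly_eqI)
    (simp add: coeff_map_poly additive_rules[OF assms])

lemma additive_pCons_0: "additive (pCons (0 :: 'a::ab_group_add))"
  by (rule additive.intro) simp

lemma additive_compose: "additive f \<Longrightarrow> additive g \<Longrightarrow> additive (\<lambda>x. f (g x))"
  by (simp add: additive_def)

lemma additive_plus: "additive f \<Longrightarrow> additive g \<Longrightarrow> additive (\<lambda>x. f x + g x)"
  by (simp add: additive_def algebra_simps)

lemma additive_uminus: "additive f \<Longrightarrow> additive (\<lambda>x. - f x)"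
  by (simp add: additive_def)

lemma subst_var_0: "additive h \<Longrightarrow> subst_var T h 0 = 0"
  by (simp add: subst_var_def additive_rules)

text \<open>
  The Horner scheme for substitution. All later facts on \<^const>\<open>subst_var\<close> are obtained from it
  by induction over the polynomial, so that degrees are never mentioned again.
\<close>

lemma subst_var_pCons:
  assumes "additive T" and "additive h"
  shows "subst_var T h (pCons a F) = h a + T (subst_var T h F)"
proof (cases "F = 0")
  case True
  then show ?thesis
    using assms by (simp add: subst_var_def additive_rules)
next
  case False
  then show ?thesis
    by (simp add: subst_var_def sum.atMost_Suc_shift additive.sum[OF assms(1)] del: sum.atMost_Suc)
qed

lemma subst_var_add:
  assumes "additive T" and "additive h"
  shows "subst_var T h (F + G) = subst_var T h F + subst_var T h G"
  by (induction F G rule: poly_induct2)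
    (simp_all add: subst_var_0 subst_var_pCons assms additive_rules(1)[OF assms(1)]
      additive_rules(1)[OF assms(2)] algebra_simps)

lemma additive_subst_var:
  assumes "additive T" and "additive h"
  shows "additive (subst_var T h)"
  by (rule additive.intro) (rule subst_var_add[OF assms])

lemma subst_var_apply:
  assumes T: "additive T" and h: "additive h" and G: "additive G"
    and "\<And>x. G (T x) = T (G x)"
  shows "subst_var T (\<lambda>x. G (h x)) F = G (subst_var T h F)"
  by (induction F)
    (simp_all add: subst_var_0 subst_var_pCons T h additive_compose[OF G h]
      additive_rules[OF G] assms(4))

lemma subst_var_map_poly:
  assumes T: "additive T" and h: "additive h" and G: "additive G" and G': "additive G'"
    and "\<And>x. h (G' x) = G (h x)" and "\<And>x. G (T x) = T (G x)"
  shows "subst_var T h (map_poly G' F) = G (subst_var T h F)"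
  by (induction F)
    (simp_all add: subst_var_0 subst_var_pCons T h map_poly_pCons additive_rules[OF G]
      additive_rules(2)[OF G'] assms(5,6))

lemma subst_var_plus:
  assumes T: "additive T" and h: "additive h" and k: "additive k"
  shows "subst_var T (\<lambda>x. h x + k x) F = subst_var T h F + subst_var T k F"
  by (induction F)
    (simp_all add: subst_var_0 subst_var_pCons T h k additive_plus[OF h k]
      additive_rules[OF T] algebra_simps)

section \<open>The operators on polynomials in two variables\<close>

text \<open>The action of \<open>\<partial>\<close> on the coefficients of an element of \<open>A[\<lambda>,\<mu>]\<close>.\<close>

definition lift_del :: "('a \<Rightarrow> 'a) \<Rightarrow> 'a::ab_group_add poly poly \<Rightarrow> 'a poly poly"
  where "lift_del D = map_poly (map_poly D)"

lemma additive_mult_lam: "additive mult_lam"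
  unfolding mult_lam_def by (rule additive_pCons_0)

lemma additive_mult_mu: "additive mult_mu"
  unfolding mult_mu_def by (rule additive_map_poly[OF additive_pCons_0])

lemma additive_mult_lam_mu: "additive mult_lam_mu"
  unfolding mult_lam_mu_def by (rule additive_plus[OF additive_mult_lam additive_mult_mu])

lemma additive_const2: "additive const2"
  by (rule additive.intro) (simp add: const2_def)

lemma additive_lift_del: "additive D \<Longrightarrow> additive (lift_del D)"
  unfolding lift_del_def by (intro additive_map_poly)

lemma mult_lam_mu_commute: "mult_lam (mult_mu X) = mult_mu (mult_lam X)"
  by (simp add: mult_lam_def mult_mu_def map_poly_pCons)

lemma lift_del_mult_lam: "additive D \<Longrightarrow> lift_del D (mult_lam X) = mult_lam (lift_del D X)"
  by (simp add: lift_del_def mult_lam_def map_poly_pCons)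

lemma lift_del_mult_mu: "additive D \<Longrightarrow> lift_del D (mult_mu X) = mult_mu (lift_del D X)"
  by (intro poly_eqI)
    (simp add: lift_del_def mult_mu_def coeff_map_poly map_poly_pCons additive_rules)

lemma lift_del_const2: "additive D \<Longrightarrow> lift_del D (const2 x) = const2 (D x)"
  by (simp add: lift_del_def const2_def map_poly_pCons additive_rules)

section \<open>Sesquilinear maps\<close>

locale sesquilinear =
  fixes D :: "'a::ab_group_add \<Rightarrow> 'a" and f :: "'a \<Rightarrow> 'a \<Rightarrow> 'a poly"
  assumes additive_D: "additive D"
    and additive_left: "additive (\<lambda>a. f a b)"
    and additive_right: "additive (f a)"
    and D_left: "f (D a) b = - pCons 0 (f a b)"
    and D_right: "f a (D b) = map_poly D (f a b) + pCons 0 (f a b)"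

text \<open>
  The pattern shared by the three-fold expressions in the associative, Jacobi and Leibniz
  identities, with \<open>a\<close> paired to \<open>\<lambda>\<close> and \<open>b\<close> to \<open>\<mu>\<close>.
\<close>

locale sesquilinear3 =
  fixes D :: "'a::ab_group_add \<Rightarrow> 'a" and F :: "'a \<Rightarrow> 'a \<Rightarrow> 'a \<Rightarrow> 'a poly poly"
  assumes additive_1: "additive (\<lambda>a. F a b c)"
    and additive_2: "additive (\<lambda>b. F a b c)"
    and additive_3: "additive (\<lambda>c. F a b c)"
    and D_1: "F (D a) b c = - mult_lam (F a b c)"
    and D_2: "F a (D b) c = - mult_mu (F a b c)"
    and D_3: "F a b (D c) = lift_del D (F a b c) + mult_lam_mu (F a b c)"

lemma sesquilinear3_plus:
  assumes "additive D" and F: "sesquilinear3 D F" and G: "sesquilinear3 D G"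
  shows "sesquilinear3 D (\<lambda>a b c. F a b c + G a b c)"
  using assms(1)
  by unfold_locales
    (simp_all add: sesquilinear3.D_1[OF F] sesquilinear3.D_2[OF F] sesquilinear3.D_3[OF F]
      sesquilinear3.D_1[OF G] sesquilinear3.D_2[OF G] sesquilinear3.D_3[OF G]
      additive.add[OF sesquilinear3.additive_1[OF F]] additive.add[OF sesquilinear3.additive_1[OF G]]
      additive.add[OF sesquilinear3.additive_2[OF F]] additive.add[OF sesquilinear3.additive_2[OF G]]
      additive.add[OF sesquilinear3.additive_3[OF F]] additive.add[OF sesquilinear3.additive_3[OF G]]
      additive_rules(1)[OF additive_lift_del] mult_lam_mu_def additive.add[OF additive_mult_lam]
      additive.add[OF additive_mult_mu] algebra_simps)

text \<open>
  Multiplication \<open>T\<close> by \<open>\<lambda>\<close>, \<open>\<mu>\<close> or \<open>\<lambda> + \<mu>\<close> gives a map from polynomials in one variable to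
  polynomials in \<open>\<lambda>\<close> and \<open>\<mu>\<close>, which puts that expression in place of the variable.
\<close>

context
  fixes D :: "'a::ab_group_add \<Rightarrow> 'a" and T :: "'a poly poly \<Rightarrow> 'a poly poly"
  assumes D: "additive D" and T: "additive T" and comm: "\<And>X. lift_del D (T X) = T (lift_del D X)"
begin

abbreviation emb :: "'a poly \<Rightarrow> 'a poly poly" where "emb \<equiv> subst_var T const2"

lemma emb_rules:
  shows "emb (F + G) = emb F + emb G" and "emb (- F) = - emb F"
    and "emb (pCons 0 F) = T (emb F)" and "emb (map_poly D F) = lift_del D (emb F)"
proof -
  have emb: "additive emb"
    by (rule additive_subst_var[OF T additive_const2])
  show "emb (F + G) = emb F + emb G" and "emb (- F) = - emb F"
    by (rule additive.add[OF emb] additive.minus[OF emb])+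
  show "emb (pCons 0 F) = T (emb F)"
    by (simp add: subst_var_pCons T additive_const2 additive.zero[OF additive_const2])
  show "emb (map_poly D F) = lift_del D (emb F)"
    by (rule subst_var_map_poly)
      (simp_all add: T D additive_const2 additive_lift_del lift_del_const2 comm)
qed

end

text \<open>
  The expressions \<open>a f\<^sub>\<lambda> (b g\<^sub>\<mu> c)\<close> and \<open>b f\<^sub>\<mu> (a g\<^sub>\<lambda> c)\<close> differ only by which of the two variables
  comes first, so both are covered by one computation with commuting operators \<open>S\<close> and \<open>T\<close>.
  In the third argument, \<open>\<partial>c\<close> gives \<open>(\<partial> + T)(b g c)\<close>, and pulling this \<open>\<partial>\<close> through the outer
  product adds \<open>S\<close>.
\<close>

lemma nested_subst_sesquilinear:
  fixes S T :: "'a::ab_group_add poly poly \<Rightarrow> 'a poly poly"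
  assumes f: "sesquilinear D f" and g: "sesquilinear D g"
    and S: "additive S" and T: "additive T"
    and DS: "\<And>X. lift_del D (S X) = S (lift_del D X)"
    and DT: "\<And>X. lift_del D (T X) = T (lift_del D X)"
    and ST: "\<And>X. S (T X) = T (S X)"
  defines "N \<equiv> \<lambda>a b c. subst_var T (\<lambda>x. subst_var S const2 (f a x)) (g b c)"
  shows "N (a + a') b c = N a b c + N a' b c"
    and "N a (b + b') c = N a b c + N a b' c"
    and "N a b (c + c') = N a b c + N a b c'"
    and "N (D a) b c = - S (N a b c)"
    and "N a (D b) c = - T (N a b c)"
    and "N a b (D c) = lift_del D (N a b c) + (S (N a b c) + T (N a b c))"
proof -
  interpret f: sesquilinear D f by (rule f)
  interpret g: sesquilinear D g by (rule g)
  note D = f.additive_D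
  note emb = emb_rules[where T = S, OF D S DS]
  define h where "h a x = subst_var S const2 (f a x)" for a x
  have h_left: "additive (\<lambda>a. h a x)" for x
    unfolding h_def
    by (rule additive_compose[OF additive_subst_var[OF S additive_const2] f.additive_left])
  have h_right: "additive (h a)" for a
    unfolding h_def
    by (rule additive_compose[OF additive_subst_var[OF S additive_const2] f.additive_right])
  have h_D_left: "h (D a) = (\<lambda>x. - S (h a x))" for a
    by (rule ext) (simp add: h_def f.D_left emb additive.minus[OF S])
  have h_D_right: "h a (D x) = lift_del D (h a x) + S (h a x)" for a x
    by (simp add: h_def f.D_right emb)
  have N: "N a b c = subst_var T (h a) (g b c)" for a b c
    by (simp add: N_def h_def[abs_def])
  note add = subst_var_add[OF T h_right]
  have h_add: "h (a + a') = (\<lambda>x. h a x + h a' x)" for a a'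
    by (rule ext) (rule additive.add[OF h_left])
  show "N (a + a') b c = N a b c + N a' b c"
    unfolding N h_add by (rule subst_var_plus[OF T h_right h_right])
  show "N a (b + b') c = N a b c + N a b' c"
    by (simp add: N additive.add[OF g.additive_left] add)
  show "N a b (c + c') = N a b c + N a b c'"
    by (simp add: N additive.add[OF g.additive_right] add)
  show "N (D a) b c = - S (N a b c)"
    unfolding N h_D_left
    by (rule subst_var_apply[OF T h_right additive_uminus[OF S]])
      (simp add: ST additive.minus[OF T])
  show "N a (D b) c = - T (N a b c)"
    by (simp add: N g.D_left additive.minus[OF T] additive.minus[OF additive_subst_var[OF T h_right]]
        subst_var_pCons[OF T h_right] additive_rules[OF h_right])
  have "subst_var T (h a) (map_poly D (g b c))
      = lift_del D (subst_var T (h a) (g b c)) + S (subst_var T (h a) (g b c))"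
    by (rule subst_var_map_poly[OF T h_right additive_plus[OF additive_lift_del[OF D] S] D])
      (simp_all add: h_D_right DT ST additive.add[OF T])
  then show "N a b (D c) = lift_del D (N a b c) + (S (N a b c) + T (N a b c))"
    by (simp add: N g.D_right add subst_var_pCons[OF T h_right] additive_rules[OF h_right]
        add.assoc)
qed

lemma sesquilinear3_lam_of_mu:
  assumes f: "sesquilinear D f" and g: "sesquilinear D g"
  shows "sesquilinear3 D (lam_of_mu f g)"
proof -
  note D = sesquilinear.additive_D[OF f]
  note N = nested_subst_sesquilinear[OF f g additive_mult_lam additive_mult_mu
      lift_del_mult_lam[OF D] lift_del_mult_mu[OF D] mult_lam_mu_commute]
  show ?thesis
    by unfold_locales (simp_all only: lam_of_mu_def N mult_lam_mu_def)
qed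

lemma sesquilinear3_mu_of_lam:
  assumes f: "sesquilinear D f" and g: "sesquilinear D g"
  shows "sesquilinear3 D (\<lambda>a b c. mu_of_lam f g b a c)"
proof -
  note D = sesquilinear.additive_D[OF f]
  note N = nested_subst_sesquilinear[OF f g additive_mult_mu additive_mult_lam
      lift_del_mult_mu[OF D] lift_del_mult_lam[OF D] mult_lam_mu_commute[symmetric]]
  show ?thesis
    by unfold_locales (simp_all only: mu_of_lam_def N, simp_all only: mult_lam_mu_def add.commute)
qed

text \<open>
  Here \<open>\<partial>b\<close> gives \<open>(\<partial> + \<lambda>)(a f\<^sub>\<lambda> b)\<close> inside, and \<open>\<partial>\<close> in the left argument of the outer product
  becomes \<open>-(\<lambda> + \<mu>)\<close>: what remains is \<open>-\<mu>\<close>, in agreement with the other two expressions.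
\<close>

lemma sesquilinear3_lam_then_sum:
  assumes f: "sesquilinear D f" and g: "sesquilinear D g"
  shows "sesquilinear3 D (lam_then_sum f g)"
proof -
  interpret f: sesquilinear D f by (rule f)
  interpret g: sesquilinear D g by (rule g)
  note D = f.additive_D
  let ?S = mult_lam_mu and ?T = mult_lam
  note S = additive_mult_lam_mu and T = additive_mult_lam
  have DS: "lift_del D (?S X) = ?S (lift_del D X)" for X
    by (simp add: mult_lam_mu_def additive.add[OF additive_lift_del[OF D]]
        lift_del_mult_lam[OF D] lift_del_mult_mu[OF D])
  have TS: "?S (?T X) = ?T (?S X)" for X
    by (simp add: mult_lam_mu_def mult_lam_mu_commute additive.add[OF T])
  note emb = emb_rules[where T = mult_lam_mu, OF D S DS]
  define h where "h c x = subst_var ?S const2 (g x c)" for c x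
  have h_left: "additive (h c)" for c
    unfolding h_def
    by (rule additive_compose[OF additive_subst_var[OF S additive_const2] g.additive_left])
  have h_right: "additive (\<lambda>c. h c x)" for x
    unfolding h_def
    by (rule additive_compose[OF additive_subst_var[OF S additive_const2] g.additive_right])
  have h_D_left: "h c (D x) = - ?S (h c x)" for c x
    by (simp add: h_def g.D_left emb additive.minus[OF S])
  have h_D_right: "h (D c) = (\<lambda>x. lift_del D (h c x) + ?S (h c x))" for c
    by (rule ext) (simp add: h_def g.D_right emb)
  have h_add: "h (c + c') = (\<lambda>x. h c x + h c' x)" for c c'
    by (rule ext) (rule additive.add[OF h_right])
  have N: "lam_then_sum f g a b c = subst_var ?T (h c) (f a b)" for a b c
    by (simp add: lam_then_sum_def h_def[abs_def])
  note add = subst_var_add[OF T h_left]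
  have left: "subst_var ?T (h c) (- pCons 0 F) = - ?T (subst_var ?T (h c) F)" for c F
    by (simp add: additive.minus[OF additive_subst_var[OF T h_left]] additive.minus[OF T]
        subst_var_pCons[OF T h_left] additive_rules[OF h_left])
  show ?thesis
  proof (unfold_locales, unfold N)
    fix a a' b b' c c'
    show "subst_var ?T (h c) (f (a + a') b)
        = subst_var ?T (h c) (f a b) + subst_var ?T (h c) (f a' b)"
      by (simp add: additive.add[OF f.additive_left] add)
    show "subst_var ?T (h c) (f a (b + b'))
        = subst_var ?T (h c) (f a b) + subst_var ?T (h c) (f a b')"
      by (simp add: additive.add[OF f.additive_right] add)
    show "subst_var ?T (h (c + c')) (f a b)
        = subst_var ?T (h c) (f a b) + subst_var ?T (h c') (f a b)"
      unfolding h_add by (rule subst_var_plus[OF T h_left h_left])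
    show "subst_var ?T (h c) (f (D a) b) = - ?T (subst_var ?T (h c) (f a b))"
      by (simp only: f.D_left left)
    have "subst_var ?T (h c) (map_poly D (f a b)) = - ?S (subst_var ?T (h c) (f a b))"
      by (rule subst_var_map_poly[OF T h_left additive_uminus[OF S] D])
        (simp_all add: h_D_left TS additive.minus[OF T])
    then show "subst_var ?T (h c) (f a (D b)) = - mult_mu (subst_var ?T (h c) (f a b))"
      by (simp add: f.D_right add subst_var_pCons[OF T h_left] additive_rules[OF h_left]
          mult_lam_mu_def)
    show "subst_var ?T (h (D c)) (f a b)
        = lift_del D (subst_var ?T (h c) (f a b)) + ?S (subst_var ?T (h c) (f a b))"
      unfolding h_D_right
      by (rule subst_var_apply[OF T h_left additive_plus[OF additive_lift_del[OF D] S]])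
        (simp add: lift_del_mult_lam[OF D] TS additive.add[OF T])
  qed
qed

lemma sesquilinear_uminus:
  assumes "sesquilinear D f"
  shows "sesquilinear D (\<lambda>a b. - f a b)"
proof -
  interpret sesquilinear D f by fact
  show ?thesis
    by unfold_locales
      (simp_all add: additive.add[OF additive_D] additive.add[OF additive_left]
        additive.add[OF additive_right] D_left D_right additive.minus[OF additive_map_poly[OF additive_D]])
qed

context
  fixes act :: "complex poly \<Rightarrow> 'a::ab_group_add \<Rightarrow> 'a"
  assumes D: "additive (del act)"
begin

lemma additive_skew_var: "additive (\<lambda>X. - pCons 0 X - map_poly (del act) X)"
  by (rule additive.intro) (simp add: additive.add[OF additive_map_poly[OF D]])

lemma additive_constant_poly: "additive (\<lambda>x :: 'a. [:x:])"
  by (rule additive.intro) simp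

lemma additive_skew_subst: "additive (skew_subst act)"
  unfolding skew_subst_def by (rule additive_subst_var[OF additive_skew_var additive_constant_poly])

lemma skew_subst_pCons:
  "skew_subst act (pCons x F)
    = [:x:] + (- pCons 0 (skew_subst act F) - map_poly (del act) (skew_subst act F))"
  unfolding skew_subst_def by (rule subst_var_pCons[OF additive_skew_var additive_constant_poly])

lemma skew_subst_map_del:
  "skew_subst act (map_poly (del act) F) = map_poly (del act) (skew_subst act F)"
  unfolding skew_subst_def
  by (rule subst_var_map_poly[OF additive_skew_var additive_constant_poly additive_map_poly[OF D] D])
    (simp_all add: map_poly_pCons additive.zero[OF D] additive_rules[OF additive_map_poly[OF D]])

lemma skew_subst_linear: "skew_subst act [:p, q:] = [:p - del act q, - q:]"
  by (simp add: skew_subst_pCons additive.zero[OF additive_skew_subst] map_poly_pCons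
      additive.zero[OF D])

end

text \<open>
  Skew-symmetry and commutativity compare \<open>f\<close> with this map: exchanging the arguments exchanges the
  factors \<open>-\<lambda>\<close> and \<open>\<partial> + \<lambda>\<close>, and replacing \<open>\<lambda>\<close> by \<open>-\<lambda>-\<partial>\<close> exchanges them back.
\<close>

lemma sesquilinear_skew_subst:
  assumes "sesquilinear (del act) f"
  shows "sesquilinear (del act) (\<lambda>a b. skew_subst act (f b a))"
proof -
  interpret sesquilinear "del act" f by fact
  note S = additive_skew_subst[of act, OF additive_D]
  have step: "skew_subst act (pCons 0 F)
      = - pCons 0 (skew_subst act F) - map_poly (del act) (skew_subst act F)" for F
    by (simp add: skew_subst_pCons[of act, OF additive_D])
  show ?thesis
    by unfold_locales
      (simp_all only: additive.add[OF additive_D] additive.add[OF additive_left]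
        additive.add[OF additive_right] D_left D_right additive.add[OF S] additive.minus[OF S]
        skew_subst_map_del[of act, OF additive_D] step, simp_all)
qed

section \<open>Identities on the free module follow from identities on constants\<close>

lemma additive_poly_eqI:
  fixes f g :: "'v::ab_group_add poly \<Rightarrow> 'b::ab_group_add"
  assumes f: "additive f" and g: "additive g"
    and const: "\<And>v. f [:v:] = g [:v:]"
    and step: "\<And>p. f p = g p \<Longrightarrow> f (pCons 0 p) = g (pCons 0 p)"
  shows "f p = g p"
proof (induction p)
  case 0
  then show ?case
    by (simp add: additive.zero[OF f] additive.zero[OF g])
next
  case (pCons v p)
  have "f ([:v:] + pCons 0 p) = g ([:v:] + pCons 0 p)"
    by (simp only: additive.add[OF f] additive.add[OF g] const step[OF pCons.IH])
  then show ?case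
    by simp
qed

lemma sesquilinear_eqI:
  fixes f g :: "'v::ab_group_add poly \<Rightarrow> 'v poly \<Rightarrow> 'v poly poly"
  assumes f: "sesquilinear (pCons 0) f" and g: "sesquilinear (pCons 0) g"
    and const: "\<And>a b. f [:a:] [:b:] = g [:a:] [:b:]"
  shows "f p q = g p q"
proof -
  interpret f: sesquilinear "pCons 0" f by (rule f)
  interpret g: sesquilinear "pCons 0" g by (rule g)
  have q: "f [:a:] q = g [:a:] q" for a
    by (rule additive_poly_eqI[OF f.additive_right g.additive_right])
      (simp_all add: const f.D_right g.D_right)
  show ?thesis
    by (rule additive_poly_eqI[OF f.additive_left g.additive_left])
      (simp_all add: q f.D_left g.D_left)
qed

lemma sesquilinear3_eqI:
  fixes F G :: "'v::ab_group_add poly \<Rightarrow> 'v poly \<Rightarrow> 'v poly \<Rightarrow> 'v poly poly poly"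
  assumes F: "sesquilinear3 (pCons 0) F" and G: "sesquilinear3 (pCons 0) G"
    and const: "\<And>a b c. F [:a:] [:b:] [:c:] = G [:a:] [:b:] [:c:]"
  shows "F p q r = G p q r"
proof -
  interpret F: sesquilinear3 "pCons 0" F by (rule F)
  interpret G: sesquilinear3 "pCons 0" G by (rule G)
  have r: "F [:a:] [:b:] r = G [:a:] [:b:] r" for a b
    by (rule additive_poly_eqI[OF F.additive_3 G.additive_3])
      (simp_all add: const F.D_3 G.D_3)
  have qr: "F [:a:] q r = G [:a:] q r" for a
    by (rule additive_poly_eqI[OF F.additive_2 G.additive_2])
      (simp_all add: r F.D_2 G.D_2)
  show ?thesis
    by (rule additive_poly_eqI[OF F.additive_1 G.additive_1])
      (simp_all add: qr F.D_1 G.D_1)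
qed

section \<open>Values on constants\<close>

text \<open>
  One of the two products in a three-fold expression is applied to a value of the other,
  which is of degree one in \<open>\<partial>\<close>.
\<close>

lemma sesquilinear_on_linear_polys:
  fixes f :: "'v::ab_group_add poly \<Rightarrow> 'v poly \<Rightarrow> 'v poly poly"
  assumes f: "sesquilinear (pCons 0) f"
    and val: "\<And>a b. f [:a:] [:b:] = [:[:w a b, u a b:], [:v a b:]:]"
  shows "f [:a:] [:b, b':] =
      [:[:w a b, u a b + w a b', u a b':], [:v a b + w a b', v a b' + u a b':], [:v a b':]:]"
    and "f [:a, a':] [:b:] =
      [:[:w a b, u a b:], [:v a b - w a' b, - u a' b:], [:- v a' b:]:]"
proof -
  interpret sesquilinear "pCons 0" f by (rule f)
  have split: "[:x, x':] = [:x:] + pCons 0 [:x':]" for x x' :: 'v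
    by simp
  show "f [:a:] [:b, b':] =
      [:[:w a b, u a b + w a b', u a b':], [:v a b + w a b', v a b' + u a b':], [:v a b':]:]"
    by (subst split, simp only: additive.add[OF additive_right] D_right val)
      (simp add: map_poly_pCons add_ac)
  show "f [:a, a':] [:b:] =
      [:[:w a b, u a b:], [:v a b - w a' b, - u a' b:], [:- v a' b:]:]"
    by (subst split, simp only: additive.add[OF additive_left] D_left val) simp
qed

context
  fixes f g :: "'v::ab_group_add poly \<Rightarrow> 'v poly \<Rightarrow> 'v poly poly"
    and fu fv fw gu gv gw :: "'v \<Rightarrow> 'v \<Rightarrow> 'v"
  assumes f: "sesquilinear (pCons 0) f" and g: "sesquilinear (pCons 0) g"
    and f_val: "\<And>a b. f [:a:] [:b:] = [:[:fw a b, fu a b:], [:fv a b:]:]"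
    and g_val: "\<And>a b. g [:a:] [:b:] = [:[:gw a b, gu a b:], [:gv a b:]:]"
begin

lemma lam_of_mu_quadratic:
  "lam_of_mu f g [:a:] [:b:] [:c:] =
    [:[:[:fw a (gw b c), fu a (gw b c) + fw a (gu b c), fu a (gu b c):],
        [:fw a (gv b c), fu a (gv b c):]:],
      [:[:fv a (gw b c) + fw a (gu b c), fv a (gu b c) + fu a (gu b c):],
        [:fv a (gv b c):]:],
      [:[:fv a (gu b c):]:]:]"
proof -
  note sv = subst_var_pCons[OF additive_mult_lam additive_const2]
    subst_var_0[OF additive_const2]
  have h: "additive (\<lambda>x. subst_var mult_lam const2 (f [:a:] x))"
    by (rule additive_compose[OF additive_subst_var[OF additive_mult_lam additive_const2]
          sesquilinear.additive_right[OF f]])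
  show ?thesis
    by (simp add: lam_of_mu_def g_val subst_var_pCons[OF additive_mult_mu h] subst_var_0[OF h]
        sesquilinear_on_linear_polys[OF f f_val] f_val sv)
      (simp add: const2_def mult_lam_def mult_mu_def map_poly_pCons add_ac)
qed

lemma mu_of_lam_quadratic:
  "mu_of_lam f g [:b:] [:a:] [:c:] =
    [:[:[:fw b (gw a c), fu b (gw a c) + fw b (gu a c), fu b (gu a c):],
        [:fv b (gw a c) + fw b (gu a c), fv b (gu a c) + fu b (gu a c):],
        [:fv b (gu a c):]:],
      [:[:fw b (gv a c), fu b (gv a c):], [:fv b (gv a c):]:]:]"
proof -
  note sv = subst_var_pCons[OF additive_mult_mu additive_const2]
    subst_var_0[OF additive_const2]
  have h: "additive (\<lambda>x. subst_var mult_mu const2 (f [:b:] x))"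
    by (rule additive_compose[OF additive_subst_var[OF additive_mult_mu additive_const2]
          sesquilinear.additive_right[OF f]])
  show ?thesis
    by (simp add: mu_of_lam_def g_val subst_var_pCons[OF additive_mult_lam h] subst_var_0[OF h]
        sesquilinear_on_linear_polys[OF f f_val] f_val sv)
      (simp add: const2_def mult_lam_def mult_mu_def map_poly_pCons add_ac)
qed

lemma lam_then_sum_quadratic:
  "lam_then_sum f g [:a:] [:b:] [:c:] =
    [:[:[:gw (fw a b) c, gu (fw a b) c:],
        [:gv (fw a b) c - gw (fu a b) c, - gu (fu a b) c:],
        [:- gv (fu a b) c:]:],
      [:[:gv (fw a b) c - gw (fu a b) c + gw (fv a b) c, gu (fv a b) c - gu (fu a b) c:],
        [:gv (fv a b) c - gv (fu a b) c - gv (fu a b) c:]:],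
      [:[:gv (fv a b) c - gv (fu a b) c:]:]:]"
proof -
  note sv = subst_var_pCons[OF additive_mult_lam_mu additive_const2]
    subst_var_0[OF additive_const2]
  have h: "additive (\<lambda>x. subst_var mult_lam_mu const2 (g x [:c:]))"
    by (rule additive_compose[OF additive_subst_var[OF additive_mult_lam_mu additive_const2]
          sesquilinear.additive_left[OF g]])
  show ?thesis
    by (simp add: lam_then_sum_def f_val subst_var_pCons[OF additive_mult_lam h] subst_var_0[OF h]
        sesquilinear_on_linear_polys[OF g g_val] g_val sv)
      (simp add: const2_def mult_lam_def mult_mu_def mult_lam_mu_def map_poly_pCons algebra_simps)
qed

end

section \<open>Bilinearity of the structure maps\<close>

lemma cbilinear_rules:
  assumes "cbilinear s1 s2 s3 f"
  shows "f (x + y) z = f x z + f y z" and "f z' (x' + y') = f z' x' + f z' y'"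
    and "f (- x) z = - f x z" and "f z' (- x') = - f z' x'" and "f 0 z = 0" and "f z' 0 = 0"
proof -
  have r: "additive (f a)" and l: "additive (\<lambda>a. f a b)" for a b
    using assms
    by (simp_all add: cbilinear_def Vector_Spaces.linear_def module_hom_def module_hom_axioms_def
        additive_def)
  show "f (x + y) z = f x z + f y z" and "f (- x) z = - f x z" and "f 0 z = 0"
    by (rule additive.add[OF l] additive.minus[OF l] additive.zero[OF l])+
  show "f z' (x' + y') = f z' x' + f z' y'" and "f z' (- x') = - f z' x'" and "f z' 0 = 0"
    by (rule additive.add[OF r] additive.minus[OF r] additive.zero[OF r])+
qed

lemma (in conformal_algebra) sesquilinear_lprod: "sesquilinear (del act) lprod"
  by unfold_locales
    (simp_all add: scale_right_distrib cbilinear_rules[OF lprod_bilinear] lprod_del_left lprod_del_right)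

text \<open>
  The operations on \<open>V\<close> are coefficients of the structure maps on constants; this is where their
  bilinearity comes from.
\<close>

lemma cbilinear_coeff:
  fixes scale :: "complex \<Rightarrow> 'v::ab_group_add \<Rightarrow> 'v"
  assumes "vector_space scale" and "conformal_algebra (free_act scale) f"
  shows "cbilinear scale scale scale (\<lambda>a b. coeff (coeff (f [:a:] [:b:]) i) j)"
proof -
  interpret V: vector_space scale by fact
  interpret conformal_algebra "free_act scale" f by fact
  have act: "free_act scale [:c:] = map_poly (scale c)" for c
    by (rule ext) (rule free_act_const[OF assms(1)])
  have s: "[:scale c a:] = free_act scale [:c:] [:a:]" for c a
    by (simp add: act map_poly_pCons)
  have "f [:scale c a:] y = map_poly (map_poly (scale c)) (f [:a:] y)"
    and "f y [:scale c a:] = map_poly (map_poly (scale c)) (f y [:a:])" for c a y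
    using lprod_bilinear
    unfolding s cbilinear_def Vector_Spaces.linear_def module_hom_def module_hom_axioms_def
    by (simp_all add: act)
  moreover have "f [:a + b:] y = f [:a:] y + f [:b:] y"
    and "f y [:a + b:] = f y [:a:] + f y [:b:]" for a b y
    using cbilinear_rules(1)[OF lprod_bilinear, of "[:a:]" "[:b:]"]
      cbilinear_rules(2)[OF lprod_bilinear, of _ "[:a:]" "[:b:]"] by simp_all
  ultimately show ?thesis
    unfolding cbilinear_def Vector_Spaces.linear_def module_hom_def module_hom_axioms_def
    by (simp add: assms(1) V.module_axioms coeff_map_poly)
qed

section \<open>Comparison of coefficients\<close>

context
  fixes br ast mult :: "'v::ab_group_add \<Rightarrow> 'v \<Rightarrow> 'v"
    and lbr lprod :: "'v poly \<Rightarrow> 'v poly \<Rightarrow> 'v poly poly"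
    and s :: "complex \<Rightarrow> 'v \<Rightarrow> 'v"
  assumes lbr: "sesquilinear (pCons 0) lbr"
    and lbr_val: "\<And>a b. lbr [:a:] [:b:] = [:[:br b a, ast b a:], [:ast a b + ast b a:]:]"
    and lprod: "sesquilinear (pCons 0) lprod"
    and lprod_val: "\<And>a b. lprod [:a:] [:b:] = [:[:mult a b:]:]"
    and ast: "cbilinear s s s ast"
    and br: "cbilinear s s s br"
    and mult: "cbilinear s s s mult"
    and skew: "\<And>a b. br a b = - br b a"
begin

text \<open>
  A current product is a quadratic one without \<open>\<partial>\<close> and \<open>\<lambda>\<close> terms; in this form the general
  formulas for values on constants apply to it.
\<close>

lemma lprod_quadratic_val: "lprod [:a:] [:b:] = [:[:mult a b, 0:], [:0:]:]"
  by (simp add: lprod_val)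

lemma assoc_constants_iff:
  "(\<forall>a b c. lam_of_mu lprod lprod [:a:] [:b:] [:c:] = lam_then_sum lprod lprod [:a:] [:b:] [:c:])
    \<longleftrightarrow> (\<forall>a b c. mult (mult a b) c = mult a (mult b c))"
  by (auto simp add: cbilinear_rules[OF mult]
      lam_of_mu_quadratic[OF lprod lprod lprod_quadratic_val lprod_quadratic_val]
      lam_then_sum_quadratic[OF lprod lprod lprod_quadratic_val lprod_quadratic_val])

text \<open>
  The coefficient of \<open>\<lambda>\<close> is the derivation property of \<open>a *\<close> up to a term on each side, and these
  two terms agree by the coefficient of \<open>\<partial>\<close>.
\<close>

lemma leibniz_constants_iff:
  "(\<forall>a b c. lam_of_mu lbr lprod [:a:] [:b:] [:c:] =
        lam_then_sum lbr lprod [:a:] [:b:] [:c:] + mu_of_lam lprod lbr [:b:] [:a:] [:c:]) \<longleftrightarrow>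
    (\<forall>a b c. br a (mult b c) = mult (br a b) c + mult b (br a c)) \<and>
    (\<forall>a b c. ast (mult b c) a = mult b (ast c a) \<and> mult b (ast c a) = mult (ast b a) c) \<and>
    (\<forall>a b c. ast a (mult b c) = mult (ast a b) c + mult b (ast a c))"
  (is "?L \<longleftrightarrow> ?leib \<and> ?comp \<and> ?der")
proof -
  have L: "?L \<longleftrightarrow> (\<forall>a b c.
      br (mult b c) a = mult (br b a) c + mult b (br c a) \<and>
      ast (mult b c) a = mult b (ast c a) \<and>
      mult b (ast c a) = mult (ast b a) c \<and>
      ast a (mult b c) + ast (mult b c) a
        = mult (ast a b) c + (mult b (ast a c) + mult b (ast c a)))"
    by (simp add: lam_of_mu_quadratic[OF lbr lprod lbr_val lprod_quadratic_val]
        lam_then_sum_quadratic[OF lbr lprod lbr_val lprod_quadratic_val]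
        mu_of_lam_quadratic[OF lprod lbr lprod_quadratic_val lbr_val]
        cbilinear_rules[OF ast] cbilinear_rules[OF br] cbilinear_rules[OF mult] algebra_simps)
  have leib: "br (mult b c) a = mult (br b a) c + mult b (br c a) \<longleftrightarrow>
      br a (mult b c) = mult (br a b) c + mult b (br a c)" for a b c
  proof -
    have "mult (br b a) c + mult b (br c a) = - (mult (br a b) c + mult b (br a c))"
      using skew[of b a] skew[of c a] by (simp add: cbilinear_rules[OF mult])
    then show ?thesis
      using skew[of "mult b c" a] by (simp only: neg_equal_iff_equal)
  qed
  have der: "ast a (mult b c) + ast (mult b c) a
        = mult (ast a b) c + (mult b (ast a c) + mult b (ast c a)) \<longleftrightarrow>
      ast a (mult b c) = mult (ast a b) c + mult b (ast a c)"
    if "ast (mult b c) a = mult b (ast c a)" for a b c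
    unfolding that by (simp add: add.assoc[symmetric])
  show ?thesis
    unfolding L leib using der by blast
qed

text \<open>
  From left to right, four of the ten coefficients suffice. Conversely, right commutativity leaves
  three different products of the form \<open>(x * y) * z\<close>, and left symmetry expresses all of them
  through one of them and the products \<open>x * (y * z)\<close>; the Gel'fand-Dorfman identity at three
  arrangements of \<open>a\<close>, \<open>b\<close>, \<open>c\<close> expresses the terms \<open>x * [y,z]\<close> through the other mixed terms.
  After these substitutions both sides of every coefficient agree.
\<close>

lemma jacobi_constants_iff:
  "(\<forall>a b c. lam_of_mu lbr lbr [:a:] [:b:] [:c:] =
        lam_then_sum lbr lbr [:a:] [:b:] [:c:] + mu_of_lam lbr lbr [:b:] [:a:] [:c:]) \<longleftrightarrow>
    (\<forall>a b c. ast (ast a b) c = ast (ast a c) b) \<and>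
    (\<forall>a b c. ast (ast a b) c - ast a (ast b c) = ast (ast b a) c - ast b (ast a c)) \<and>
    (\<forall>a b c. br (ast a b) c + ast (br a b) c - ast a (br b c) - br (ast a c) b - ast (br a c) b = 0) \<and>
    (\<forall>a b c. br a (br b c) = br (br a b) c + br b (br a c))"
  (is "?L \<longleftrightarrow> ?rc \<and> ?ls \<and> ?gd \<and> ?jac")
proof -
  have L: "?L \<longleftrightarrow> (\<forall>a b c.
      br (br c b) a = br c (br b a) + br (br c a) b \<and>
      ast (br c b) a + br (ast c b) a
        = ast c (br b a) + (ast (br c a) b + br (ast c a) b) \<and>
      ast (ast c b) a = ast (ast c a) b \<and>
      br (ast b c) a + br (ast c b) a
        = ast (br b a) c + ast c (br b a) - br c (ast b a)
          + (ast b (br c a) + ast (br c a) b + br (ast c a) b) \<and>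
      ast (ast b c) a + ast (ast c b) a
        = ast b (ast c a) + ast (ast c a) b + ast (ast c a) b - ast c (ast b a) \<and>
      - ast (ast b a) c - ast c (ast b a) + (ast b (ast c a) + ast (ast c a) b) = 0 \<and>
      ast a (br c b) + ast (br c b) a + br (ast c b) a
        = ast (br b a) c + ast c (br b a) + br c (ast a b) + (br (ast a c) b + br (ast c a) b) \<and>
      ast a (ast c b) + ast (ast c b) a + ast (ast c b) a
        = ast c (ast a b) + (ast (ast a c) b + ast (ast c a) b) \<and>
      ast a (ast b c) + ast a (ast c b) + (ast (ast b c) a + ast (ast c b) a)
        = ast (ast a b) c + ast c (ast a b) - (ast (ast b a) c + ast c (ast b a))
          + (ast b (ast a c) + ast b (ast c a) + (ast (ast a c) b + ast (ast c a) b)) \<and>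
      ast a (ast c b) + ast (ast c b) a = ast (ast a b) c + ast c (ast a b))"
    (is "_ \<longleftrightarrow> (\<forall>a b c. ?P a b c)")
    by (simp add: lam_of_mu_quadratic[OF lbr lbr lbr_val lbr_val]
        lam_then_sum_quadratic[OF lbr lbr lbr_val lbr_val]
        mu_of_lam_quadratic[OF lbr lbr lbr_val lbr_val] cbilinear_rules[OF br] cbilinear_rules[OF ast])
  show ?thesis
    unfolding L
  proof (intro iffI conjI)
    assume C: "\<forall>a b c. ?P a b c"
    show rc: ?rc
      using C by blast
    show ?ls
    proof (intro allI)
      fix a b c
      (* the coefficient of \<lambda>\<^sup>2 at a, c, b *)
      have "ast a (ast b c) + ast (ast b c) a = ast (ast a c) b + ast b (ast a c)"
        using C by blast
      moreover have "ast (ast b c) a = ast (ast b a) c" "ast (ast a c) b = ast (ast a b) c"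
        using rc by blast+
      ultimately show "ast (ast a b) c - ast a (ast b c) = ast (ast b a) c - ast b (ast a c)"
        by (simp add: algebra_simps)
    qed
    show ?gd
    proof (intro allI)
      fix a b c
      (* the coefficient of \<partial> at c, b, a *)
      have "ast (br a b) c + br (ast a b) c
          = ast a (br b c) + (ast (br a c) b + br (ast a c) b)"
        using C by blast
      then show "br (ast a b) c + ast (br a b) c - ast a (br b c) - br (ast a c) b
          - ast (br a c) b = 0"
        by (simp add: algebra_simps)
    qed
    show ?jac
    proof (intro allI)
      fix a b c
      (* the constant term at c, b, a *)
      have "br (br a b) c = br a (br b c) + br (br a c) b"
        using C by blast
      then show "br a (br b c) = br (br a b) c + br b (br a c)"
        using skew[of "br a c" b] by simp
    qed
  next
    assume A: "?rc \<and> ?ls \<and> ?gd \<and> ?jac"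
    then have rc: "ast (ast x y) z = ast (ast x z) y"
      and ls: "ast (ast x y) z - ast x (ast y z) = ast (ast y x) z - ast y (ast x z)"
      and gd: "br (ast x y) z + ast (br x y) z - ast x (br y z) - br (ast x z) y
        - ast (br x z) y = 0"
      and jac: "br x (br y z) = br (br x y) z + br y (br x z)" for x y z
      by blast+
    show "\<forall>a b c. ?P a b c"
    proof (intro allI)
      fix a b c
      note R = rc[of c b a] rc[of b c a] rc[of a c b]
      have B: "ast (ast b a) c = ast (ast a b) c - ast a (ast b c) + ast b (ast a c)"
        using ls[of a b c] by (simp add: algebra_simps)
      have C: "ast (ast c a) b = ast (ast a b) c - ast a (ast c b) + ast c (ast a b)"
        using ls[of a c b] R by (simp add: algebra_simps)
      have B': "ast (ast c a) b = ast (ast b a) c - ast b (ast c a) + ast c (ast b a)"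
        using ls[of b c a] R by (simp add: algebra_simps)
      (* left symmetry expresses one product in two ways, which leaves a relation between
         the products x * (y * z) alone *)
      have D: "ast a (ast b c)
          = ast b (ast a c) - ast b (ast c a) + ast a (ast c b) - ast c (ast a b) + ast c (ast b a)"
      proof -
        have "ast (ast a b) c - ast a (ast c b) + ast c (ast a b)
            = ast (ast a b) c - ast a (ast b c) + ast b (ast a c) - ast b (ast c a) + ast c (ast b a)"
          using B' by (simp only: B C)
        then show ?thesis
          by (simp add: algebra_simps)
      qed
      have S: "br a b = - br b a" "br a c = - br c a" "br b c = - br c b"
        "br (ast a b) c = - br c (ast a b)" "br (ast b a) c = - br c (ast b a)"
        by (rule skew)+
      have G1: "ast a (br c b)
          = ast (br b a) c + br c (ast a b) + br (ast a c) b - ast (br c a) b"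
        using gd[of a b c] by (simp add: S cbilinear_rules[OF ast] algebra_simps)
      have G2: "ast b (br c a)
          = br (ast b c) a - ast (br c b) a - ast (br b a) c + br c (ast b a)"
        using gd[of b c a] by (simp add: S cbilinear_rules[OF ast] algebra_simps)
      have G3: "ast c (br b a)
          = br (ast c b) a + ast (br c b) a - br (ast c a) b - ast (br c a) b"
        using gd[of c b a] by (simp add: algebra_simps)
      have J: "br (br c b) a = br c (br b a) + br (br c a) b"
        using jac[of c b a] skew[of b "br c a"] by simp
      show "?P a b c"
        by (intro conjI J rc[of c b a]) (simp_all add: R B C D G1 G2 G3)
    qed
  qed
qed

end

section \<open>Poisson conformal structures with prescribed values on constants\<close>

context
  fixes scale :: "complex \<Rightarrow> 'v::ab_group_add \<Rightarrow> 'v"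
    and lprod lbr :: "'v poly \<Rightarrow> 'v poly \<Rightarrow> 'v poly poly"
    and ast mult br :: "'v \<Rightarrow> 'v \<Rightarrow> 'v"
  assumes vs: "vector_space scale"
    and lprod: "conformal_algebra (free_act scale) lprod"
    and lbr: "conformal_algebra (free_act scale) lbr"
    and lprod_val: "\<And>a b. lprod [:a:] [:b:] = [:[:mult a b:]:]"
    and lbr_val: "\<And>a b. lbr [:a:] [:b:] = [:[:br b a, ast b a:], [:ast a b + ast b a:]:]"
begin

lemma del_free: "del (free_act scale) = pCons 0"
  by (rule ext) (rule free_act_del[OF vs])

lemma sesq: "sesquilinear (pCons 0) lprod" "sesquilinear (pCons 0) lbr"
  using conformal_algebra.sesquilinear_lprod[OF lprod] conformal_algebra.sesquilinear_lprod[OF lbr]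
  by (simp_all add: del_free)

lemma cbilinear_operations:
  "cbilinear scale scale scale mult" "cbilinear scale scale scale ast" "cbilinear scale scale scale br"
proof -
  show "cbilinear scale scale scale mult"
    using cbilinear_coeff[OF vs lprod, of 0 0] by (simp add: lprod_val)
  show "cbilinear scale scale scale ast" "cbilinear scale scale scale br"
    using cbilinear_coeff[OF vs lbr, of 0 1] cbilinear_coeff[OF vs lbr, of 0 0]
    by (simp_all add: lbr_val cbilinear_def)
qed

lemma skew_subst_free: "skew_subst (free_act scale) [:[:w, u:], [:v:]:] = [:[:w, u - v:], [:- v:]:]"
  by (subst skew_subst_linear) (simp_all add: del_free additive_pCons_0)

lemma lbr_skew_iff:
  "(\<forall>p q. lbr p q = - skew_subst (free_act scale) (lbr q p)) \<longleftrightarrow> (\<forall>a b. br a b = - br b a)"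
proof -
  have const: "lbr [:b:] [:a:] = - skew_subst (free_act scale) (lbr [:a:] [:b:]) \<longleftrightarrow>
      br a b = - br b a" for a b
    by (simp only: lbr_val skew_subst_free) (simp add: add.commute)
  show ?thesis
    unfolding const[symmetric]
    using sesquilinear_eqI[OF sesq(2) sesquilinear_uminus
        [OF sesquilinear_skew_subst[of "free_act scale" lbr, unfolded del_free, OF sesq(2)]]]
    by blast
qed

lemma lprod_commute_iff:
  "(\<forall>p q. lprod p q = skew_subst (free_act scale) (lprod q p)) \<longleftrightarrow> (\<forall>a b. mult a b = mult b a)"
proof -
  have const: "lprod [:a:] [:b:] = skew_subst (free_act scale) (lprod [:b:] [:a:]) \<longleftrightarrow>
      mult a b = mult b a" for a b
    using skew_subst_free[of "mult b a" 0 0] by (simp add: lprod_val)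
  show ?thesis
    unfolding const[symmetric]
    using sesquilinear_eqI[OF sesq(1)
        sesquilinear_skew_subst[of "free_act scale" lprod, unfolded del_free, OF sesq(1)]]
    by blast
qed

lemma alternating_iff_skew: "(\<forall>a. br a a = 0) \<longleftrightarrow> (\<forall>a b. br a b = - br b a)"
proof (intro iffI allI)
  fix a b
  assume "\<forall>a. br a a = 0"
  then have "br (a + b) (a + b) = 0" "br a a = 0" "br b b = 0"
    by blast+
  then have "br b a + br a b = 0"
    by (simp add: cbilinear_rules[OF cbilinear_operations(3)])
  then show "br a b = - br b a"
    by (metis add.commute eq_neg_iff_add_eq_0)
next
  interpret V: vector_space scale by (rule vs)
  fix a
  assume "\<forall>a b. br a b = - br b a"
  then have "br a a + br a a = 0"
    by (metis add.right_inverse)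
  then have "scale 2 (br a a) = 0"
    using V.scale_left_distrib[of 1 1 "br a a"] by simp
  then show "br a a = 0"
    by simp
qed

text \<open>
  The coefficient comparisons presuppose a skew-symmetric \<open>br\<close>. Both sides force this, so they are
  both false if it fails.
\<close>

lemma nc_poisson_conformal_algebra_iff:
  "nc_poisson_conformal_algebra (free_act scale) lprod lbr \<longleftrightarrow>
    gd_algebra scale ast br \<and>
    nc_poisson_algebra scale mult br \<and>
    (\<forall>a b c. ast (mult b c) a = mult b (ast c a) \<and> mult b (ast c a) = mult (ast b a) c) \<and>
    (\<forall>a b c. ast a (mult b c) = mult (ast a b) c + mult b (ast a c))"
proof (cases "\<forall>a b. br a b = - br b a")
  case False
  then have "\<not> lie_conformal_algebra (free_act scale) lbr" "\<not> lie_algebra scale br"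
    using lbr_skew_iff alternating_iff_skew lie_conformal_algebra.lbr_skew lie_algebra.br_self
    by metis+
  then show ?thesis
    by (simp add: nc_poisson_conformal_algebra_def gd_algebra_def)
next
  case True
  note ops = cbilinear_operations
  note iffs = assoc_constants_iff[OF sesq(2) lbr_val sesq(1) lprod_val ops(2,3,1)]
    leibniz_constants_iff[OF sesq(2) lbr_val sesq(1) lprod_val ops(2,3,1)]
    jacobi_constants_iff[OF sesq(2) lbr_val sesq(1) lprod_val ops(2,3,1)]
  note add3 = sesquilinear3_plus[OF additive_pCons_0]
  have assoc: "(\<forall>p q r. lam_of_mu lprod lprod p q r = lam_then_sum lprod lprod p q r) \<longleftrightarrow>
      (\<forall>a b c. lam_of_mu lprod lprod [:a:] [:b:] [:c:] = lam_then_sum lprod lprod [:a:] [:b:] [:c:])"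
    using sesquilinear3_eqI[OF sesquilinear3_lam_of_mu sesquilinear3_lam_then_sum, OF sesq(1,1,1,1)]
    by blast
  have leib: "(\<forall>p q r. lam_of_mu lbr lprod p q r
        = lam_then_sum lbr lprod p q r + mu_of_lam lprod lbr q p r) \<longleftrightarrow>
      (\<forall>a b c. lam_of_mu lbr lprod [:a:] [:b:] [:c:]
        = lam_then_sum lbr lprod [:a:] [:b:] [:c:] + mu_of_lam lprod lbr [:b:] [:a:] [:c:])"
    using sesquilinear3_eqI[OF sesquilinear3_lam_of_mu add3[OF
        sesquilinear3_lam_then_sum sesquilinear3_mu_of_lam], OF sesq(2,1,2,1,1,2)]
    by blast
  have jac: "(\<forall>p q r. lam_of_mu lbr lbr p q r
        = lam_then_sum lbr lbr p q r + mu_of_lam lbr lbr q p r) \<longleftrightarrow>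
      (\<forall>a b c. lam_of_mu lbr lbr [:a:] [:b:] [:c:]
        = lam_then_sum lbr lbr [:a:] [:b:] [:c:] + mu_of_lam lbr lbr [:b:] [:a:] [:c:])"
    using sesquilinear3_eqI[OF sesquilinear3_lam_of_mu add3[OF
        sesquilinear3_lam_then_sum sesquilinear3_mu_of_lam], OF sesq(2,2,2,2,2,2)]
    by blast
  note skew = lbr_skew_iff[THEN iffD2, OF True] alternating_iff_skew[THEN iffD2, OF True]
  have skew_rules: "br a b = - br b a" for a b
    using True by blast
  show ?thesis
    unfolding nc_poisson_conformal_algebra_def nc_poisson_conformal_algebra_axioms_def
      associative_conformal_algebra_def associative_conformal_algebra_axioms_def
      lie_conformal_algebra_def lie_conformal_algebra_axioms_def assoc leib jac
      iffs[OF skew_rules]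
      gd_algebra_def gd_algebra_axioms_def lie_algebra_def lie_algebra_axioms_def
      novikov_algebra_def novikov_algebra_axioms_def nc_poisson_algebra_def
      nc_poisson_algebra_axioms_def associative_algebra_def associative_algebra_axioms_def
    using vs lprod lbr ops skew by - (rule iffI; elim conjE; intro conjI; assumption)
qed

lemma poisson_conformal_algebra_iff:
  "poisson_conformal_algebra (free_act scale) lprod lbr \<longleftrightarrow>
    nc_poisson_conformal_algebra (free_act scale) lprod lbr \<and> (\<forall>a b. mult a b = mult b a)"
  unfolding poisson_conformal_algebra_def comm_associative_conformal_algebra_def
    comm_associative_conformal_algebra_axioms_def lprod_commute_iff nc_poisson_conformal_algebra_def
  by blast

end

section \<open>Characterization of quadratic Poisson conformal algebras\<close>

text \<open>
  Skew-symmetry determines the coefficient of \<open>\<lambda>\<close> from that of \<open>\<partial>\<close>: it is the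
  symmetrization \<open>u(a,b) + u(b,a)\<close>.
\<close>

lemma quadratic_lie_bracket_form:
  assumes "quadratic_lie_conformal_algebra scale lbr"
  obtains ast br where
    "\<And>a b. lbr [:a:] [:b:] = [:[:br b a, ast b a:], [:ast a b + ast b a:]:]"
proof -
  interpret quadratic_lie_conformal_algebra scale lbr by fact
  note vs = V.vector_space_axioms
  have "\<forall>a b. \<exists>u v w. lbr [:a:] [:b:] = [:[:w, u:], [:v:]:]"
    using lbr_quadratic by (simp add: free_act_del[OF vs])
  then obtain u v w where val: "lbr [:a:] [:b:] = [:[:w a b, u a b:], [:v a b:]:]" for a b
    by metis
  have "[:[:w a b, u a b:], [:v a b:]:]
      = - skew_subst (free_act scale) [:[:w b a, u b a:], [:v b a:]:]" for a b
    using lbr_skew[of "[:a:]" "[:b:]"] by (simp add: val)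
  then have v: "v b a = u b a + u a b" for a b
    by (subst (asm) skew_subst_linear)
      (simp_all add: free_act_del[OF vs, abs_def] additive_pCons_0 algebra_simps)
  show ?thesis
    by (rule that[of "\<lambda>a b. w b a" "\<lambda>a b. u b a"]) (simp add: val v add.commute)
qed

theorem proposition2p12:
  fixes scale :: "complex \<Rightarrow> 'v::ab_group_add \<Rightarrow> 'v"
    and lprod lbr :: "'v poly \<Rightarrow> 'v poly \<Rightarrow> 'v poly poly"
  assumes "vector_space scale"
    and "conformal_algebra (free_act scale) lprod"
    and "conformal_algebra (free_act scale) lbr"
  shows
    "(quadratic_nc_poisson_conformal_algebra scale lprod lbr \<longleftrightarrow>
      (\<exists>ast mult br.
        (\<forall>a b. lprod [:a:] [:b:] = [:[:mult a b:]:]) \<and>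
        (\<forall>a b. lbr [:a:] [:b:] =
          [: del (free_act scale) [:ast b a:] + [:br b a:], [:ast a b + ast b a:] :]) \<and>
        gd_algebra scale ast br \<and>
        nc_poisson_algebra scale mult br \<and>
        (\<forall>a b c. ast (mult b c) a = mult b (ast c a) \<and> mult b (ast c a) = mult (ast b a) c) \<and>
        (\<forall>a b c. ast a (mult b c) = mult (ast a b) c + mult b (ast a c))))
     \<and>
     (quadratic_poisson_conformal_algebra scale lprod lbr \<longleftrightarrow>
      (\<exists>ast mult br.
        (\<forall>a b. lprod [:a:] [:b:] = [:[:mult a b:]:]) \<and>
        (\<forall>a b. lbr [:a:] [:b:] =
          [: del (free_act scale) [:ast b a:] + [:br b a:], [:ast a b + ast b a:] :]) \<and>
        gd_algebra scale ast br \<and>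
        poisson_algebra scale mult br \<and>
        (\<forall>a b c. ast (mult b c) a = mult b (ast c a) \<and> mult b (ast c a) = mult (ast b a) c) \<and>
        (\<forall>a b c. ast a (mult b c) = mult (ast a b) c + mult b (ast a c))))"
proof -
  note vs = assms(1)
  have del_eq: "del (free_act scale) [:u:] + [:w:] = [:w, u:]" for u w :: 'v
    by (simp add: free_act_del[OF vs])
  let ?prod = "\<lambda>mult. \<forall>a b. lprod [:a:] [:b:] = [:[:mult a b:]:]"
  let ?brac = "\<lambda>ast br. \<forall>a b. lbr [:a:] [:b:] = [:[:br b a, ast b a:], [:ast a b + ast b a:]:]"
  let ?compat1 = "\<lambda>ast mult.
    \<forall>a b c. ast (mult b c) a = mult b (ast c a) \<and> mult b (ast c a) = mult (ast b a) c"
  let ?compat2 = "\<lambda>ast mult. \<forall>a b c. ast a (mult b c) = mult (ast a b) c + mult b (ast a c)"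
  have nc_iff: "nc_poisson_conformal_algebra (free_act scale) lprod lbr \<longleftrightarrow>
      gd_algebra scale ast br \<and> nc_poisson_algebra scale mult br \<and> ?compat1 ast mult \<and> ?compat2 ast mult"
    and comm_iff: "poisson_conformal_algebra (free_act scale) lprod lbr \<longleftrightarrow>
      nc_poisson_conformal_algebra (free_act scale) lprod lbr \<and> (\<forall>a b. mult a b = mult b a)"
    if "?prod mult" "?brac ast br" for ast mult br
  proof -
    have prod: "lprod [:a:] [:b:] = [:[:mult a b:]:]"
      and brac: "lbr [:a:] [:b:] = [:[:br b a, ast b a:], [:ast a b + ast b a:]:]" for a b
      using that by blast+
    note iffs = nc_poisson_conformal_algebra_iff[OF assms prod brac]
      poisson_conformal_algebra_iff[OF assms prod brac]
    show "nc_poisson_conformal_algebra (free_act scale) lprod lbr \<longleftrightarrow>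
        gd_algebra scale ast br \<and> nc_poisson_algebra scale mult br \<and> ?compat1 ast mult \<and> ?compat2 ast mult"
      by (rule iffs(1))
    show "poisson_conformal_algebra (free_act scale) lprod lbr \<longleftrightarrow>
        nc_poisson_conformal_algebra (free_act scale) lprod lbr \<and> (\<forall>a b. mult a b = mult b a)"
      by (rule iffs(2))
  qed
  have forms: "\<exists>ast mult br. ?prod mult \<and> ?brac ast br"
    if cur: "current_associative_conformal_algebra scale lprod"
      and quad: "quadratic_lie_conformal_algebra scale lbr"
  proof -
    obtain mult where "?prod mult"
      using current_associative_conformal_algebra.lprod_current[OF cur] by blast
    moreover obtain ast br where "?brac ast br"
      using quadratic_lie_bracket_form[OF quad] by metis
    ultimately show ?thesis by blast
  qed
  have cur_quad: "current_associative_conformal_algebra scale lprod \<and>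
      quadratic_lie_conformal_algebra scale lbr"
    if nc: "nc_poisson_conformal_algebra (free_act scale) lprod lbr"
      and alg: "nc_poisson_algebra scale mult br" and vals: "?prod mult" "?brac ast br"
    for ast mult br
  proof -
    have "associative_algebra scale mult"
      using alg by (simp add: nc_poisson_algebra_def)
    with vals(1) have "\<exists>mult. associative_algebra scale mult \<and> ?prod mult"
      by (intro exI conjI)
    moreover have "\<exists>u v w. lbr [:a:] [:b:] = [:[:w, u:], [:v:]:]" for a b
      by (intro exI) (rule vals(2)[rule_format])
    ultimately show ?thesis
      using nc vs by (simp add: nc_poisson_conformal_algebra_def
        current_associative_conformal_algebra_def current_associative_conformal_algebra_axioms_def
        quadratic_lie_conformal_algebra_def quadratic_lie_conformal_algebra_axioms_def del_eq)
  qed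
  show ?thesis
    unfolding del_eq quadratic_nc_poisson_conformal_algebra_def
      quadratic_poisson_conformal_algebra_def poisson_algebra_def poisson_algebra_axioms_def
  proof (intro conjI iffI; elim conjE exE)
    assume nc: "nc_poisson_conformal_algebra (free_act scale) lprod lbr"
      and "current_associative_conformal_algebra scale lprod"
      and "quadratic_lie_conformal_algebra scale lbr"
    then obtain ast mult br where vals: "?prod mult" "?brac ast br"
      using forms by blast
    show "\<exists>ast mult br. ?prod mult \<and> ?brac ast br \<and> gd_algebra scale ast br \<and>
        nc_poisson_algebra scale mult br \<and> ?compat1 ast mult \<and> ?compat2 ast mult"
      using vals nc[unfolded nc_iff[OF vals]]
      by - (intro exI conjI; elim conjE; assumption)
  next
    fix ast mult br
    assume vals: "?prod mult" "?brac ast br"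
      and alg: "gd_algebra scale ast br" "nc_poisson_algebra scale mult br"
      and compat: "?compat1 ast mult" "?compat2 ast mult"
    have nc: "nc_poisson_conformal_algebra (free_act scale) lprod lbr"
      unfolding nc_iff[OF vals] using alg compat by (intro conjI)
    note cq = cur_quad[OF nc alg(2) vals]
    show "nc_poisson_conformal_algebra (free_act scale) lprod lbr"
      "current_associative_conformal_algebra scale lprod"
      "quadratic_lie_conformal_algebra scale lbr"
      using nc cq by simp_all
  next
    assume pc: "poisson_conformal_algebra (free_act scale) lprod lbr"
      and "current_associative_conformal_algebra scale lprod"
      and "quadratic_lie_conformal_algebra scale lbr"
    then obtain ast mult br where vals: "?prod mult" "?brac ast br"
      using forms by blast
    show "\<exists>ast mult br. ?prod mult \<and> ?brac ast br \<and> gd_algebra scale ast br \<and>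
        (nc_poisson_algebra scale mult br \<and> (\<forall>a b. mult a b = mult b a)) \<and> ?compat1 ast mult \<and> ?compat2 ast mult"
      using vals pc[unfolded comm_iff[OF vals] nc_iff[OF vals]]
      by - (intro exI conjI; elim conjE; assumption)
  next
    fix ast mult br
    assume vals: "?prod mult" "?brac ast br"
      and alg: "gd_algebra scale ast br" "nc_poisson_algebra scale mult br"
      and comm: "\<forall>a b. mult a b = mult b a"
      and compat: "?compat1 ast mult" "?compat2 ast mult"
    have nc: "nc_poisson_conformal_algebra (free_act scale) lprod lbr"
      unfolding nc_iff[OF vals] using alg compat by (intro conjI)
    note cq = cur_quad[OF nc alg(2) vals]
    show "poisson_conformal_algebra (free_act scale) lprod lbr"
      unfolding comm_iff[OF vals] using nc comm by (intro conjI)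
    show "current_associative_conformal_algebra scale lprod"
      "quadratic_lie_conformal_algebra scale lbr"
      using cq by simp_all
  qed
qed

end
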